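(* Let $T$ be a $(v, e, \lambda_{rr}, 1, \lambda_{rc} : r \times c)$ triple array (that is, a triple array whose column intersection parameter is $\lambda_{cc}=1$) with $v = r+c-1$. Then there exists an $r \times (v+1)$ triple-intersection Latin rectangle $Y$, with column intersection sizes $0$, $1$ and $2$, that is compatible with $T$.
   Context: Triple array. A $(v, e, \lambda_{rr}, \lambda_{cc}, \lambda_{rc} : r \times c)$ triple array (with $r,c\ge 2$) is an $r \times c$ array on $v$ symbols, every cell containing one symbol, such that: (TA1) no symbol is repeated in any row or column; (TA2) each symbol occurs exactly $e$ times in the array; (TA3) any two distinct rows contain exactly $\lambda_{rr}$ common symbols; (TA4) any two distinct columns contain exactly $\lambda_{cc}$ common symbols; (TA5) any row and any column contain exactly $\lambda_{rc}$ common symbols. Latin rectangle. A $k\times n$ Latin rectangle is a $k \times n$ array on $n$ symbols, every cell filled, with no repeated symbol in any row or column (so each row contains every symbol exactly once and each symbol occurs $k$ times in total). Triple-intersection Latin rectangle. Let $\lambda = \frac{k(k-1)}{n-1}$ be an integer. A $k\times n$ Latin rectangle is called a triple-intersection Latin rectangle if the numbers of symbols common to two distinct columns all lie in $\{\lambda-1,\lambda,\lambda+1\}$ and all three of these values actually occur. Compatibility. Given a $k\times n$ Latin rectangle $Y$ and a column $C_0$ of $Y$, form an array $A$ as follows: remove column $C_0$ and all occurrences in $Y$ of symbols present in $C_0$ (leaving some cells empty), and then exchange the roles of columns and symbols. Explicitly, the rows of $A$ are the rows of $Y$; the columns of $A$ are indexed by the $n-k$ symbols $s$ of $Y$ that do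 not occur in $C_0$; the symbols of $A$ are the $n-1$ columns of $Y$ other than $C_0$; and the entry of $A$ in row $i$ and column $s$ is the unique column $j$ of $Y$ with $Y(i,j)=s$. The rectangle $Y$ is compatible with an array $T$ if, for some choice of the column $C_0$, the array $A$ so obtained is $T$ (with the columns and symbols of $A$ identified by bijections with the columns and symbols of $T$). *)

theory Defs
  imports Main
begin

text \<open>
  An \<open>r \<times> c\<close> array is a function \<open>A\<close> whose entry in row \<open>i < r\<close> and column \<open>j < c\<close> is \<open>A i j\<close>;
  values outside this range are irrelevant.  The symbol set is an explicit parameter.
\<close>

definition is_array :: "nat \<Rightarrow> nat \<Rightarrow> 'a set \<Rightarrow> (nat \<Rightarrow> nat \<Rightarrow> 'a) \<Rightarrow> bool" where
  "is_array r c S A \<longleftrightarrow> (\<forall>i<r. \<forall>j<c. A i j \<in> S)"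

definition row_symbols :: "nat \<Rightarrow> (nat \<Rightarrow> nat \<Rightarrow> 'a) \<Rightarrow> nat \<Rightarrow> 'a set" where
  "row_symbols c A i = {A i j |j. j < c}"

definition column_symbols :: "nat \<Rightarrow> (nat \<Rightarrow> nat \<Rightarrow> 'a) \<Rightarrow> nat \<Rightarrow> 'a set" where
  "column_symbols r A j = {A i j |i. i < r}"

definition no_repetition :: "nat \<Rightarrow> nat \<Rightarrow> (nat \<Rightarrow> nat \<Rightarrow> 'a) \<Rightarrow> bool" where
  "no_repetition r c A \<longleftrightarrow>
     (\<forall>i<r. inj_on (\<lambda>j. A i j) {..<c}) \<and> (\<forall>j<c. inj_on (\<lambda>i. A i j) {..<r})"

definition triple_array ::
  "nat \<Rightarrow> nat \<Rightarrow> nat \<Rightarrow> nat \<Rightarrow> nat \<Rightarrow> nat \<Rightarrow> nat \<Rightarrow> 'a set \<Rightarrow> (nat \<Rightarrow> nat \<Rightarrow> 'a) \<Rightarrow> bool" where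
  "triple_array v e lrr lcc lrc r c S T \<longleftrightarrow>
     r \<ge> 2 \<and> c \<ge> 2 \<and> finite S \<and> card S = v \<and> is_array r c S T \<and>
     no_repetition r c T \<and>
     (\<forall>s\<in>S. card {(i, j). i < r \<and> j < c \<and> T i j = s} = e) \<and>
     (\<forall>i<r. \<forall>i'<r. i \<noteq> i' \<longrightarrow> card (row_symbols c T i \<inter> row_symbols c T i') = lrr) \<and>
     (\<forall>j<c. \<forall>j'<c. j \<noteq> j' \<longrightarrow> card (column_symbols r T j \<inter> column_symbols r T j') = lcc) \<and>
     (\<forall>i<r. \<forall>j<c. card (row_symbols c T i \<inter> column_symbols r T j) = lrc)"

definition latin_rectangle :: "nat \<Rightarrow> nat \<Rightarrow> 'a set \<Rightarrow> (nat \<Rightarrow> nat \<Rightarrow> 'a) \<Rightarrow> bool" where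
  "latin_rectangle k n X Y \<longleftrightarrow>
     finite X \<and> card X = n \<and> is_array k n X Y \<and> no_repetition k n Y"

definition column_intersection_sizes :: "nat \<Rightarrow> nat \<Rightarrow> (nat \<Rightarrow> nat \<Rightarrow> 'a) \<Rightarrow> int set" where
  "column_intersection_sizes k n Y =
     {int (card (column_symbols k Y j \<inter> column_symbols k Y j')) |j j'. j < n \<and> j' < n \<and> j \<noteq> j'}"

text \<open>
  Sizes are integers so that \<open>\<lambda> - 1\<close> is not truncated at \<open>0\<close>.  Equality of the two sets says both
  that only the three values occur and that each of them does.
\<close>

definition triple_intersection_latin_rectangle ::
  "nat \<Rightarrow> nat \<Rightarrow> 'a set \<Rightarrow> (nat \<Rightarrow> nat \<Rightarrow> 'a) \<Rightarrow> bool" where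
  "triple_intersection_latin_rectangle k n X Y \<longleftrightarrow>
     latin_rectangle k n X Y \<and> n \<ge> 2 \<and> (n - 1) dvd k * (k - 1) \<and>
     (let l = int (k * (k - 1) div (n - 1))
      in column_intersection_sizes k n Y = {l - 1, l, l + 1})"

text \<open>
  The array obtained from a \<open>k \<times> n\<close> Latin rectangle \<open>Y\<close> on symbol set \<open>X\<close> by removing column \<open>j0\<close>
  together with all occurrences of its symbols and then exchanging columns and symbols.  Its rows
  are those of \<open>Y\<close>, its columns are the symbols of \<open>Y\<close> not in column \<open>j0\<close>, and its symbols are the
  columns of \<open>Y\<close> other than \<open>j0\<close>.  The entry does not mention \<open>j0\<close>: in a row of \<open>Y\<close>, a symbol
  absent from column \<open>j0\<close> occurs exactly once, and not in column \<open>j0\<close>.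
\<close>

definition derived_columns :: "nat \<Rightarrow> 'a set \<Rightarrow> (nat \<Rightarrow> nat \<Rightarrow> 'a) \<Rightarrow> nat \<Rightarrow> 'a set" where
  "derived_columns k X Y j0 = X - column_symbols k Y j0"

definition derived_symbols :: "nat \<Rightarrow> nat \<Rightarrow> nat set" where
  "derived_symbols n j0 = {..<n} - {j0}"

definition derived_entry :: "nat \<Rightarrow> (nat \<Rightarrow> nat \<Rightarrow> 'a) \<Rightarrow> nat \<Rightarrow> 'a \<Rightarrow> nat" where
  "derived_entry n Y i s = (THE j. j < n \<and> Y i j = s)"

text \<open>
  Compatibility of a \<open>k \<times> n\<close> Latin rectangle \<open>Y\<close> on \<open>X\<close> with a \<open>k \<times> c\<close> array \<open>T\<close> on \<open>S\<close>; columns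
  and symbols are matched by bijections \<open>f\<close> and \<open>g\<close>, rows are matched identically.
\<close>

definition compatible ::
  "nat \<Rightarrow> nat \<Rightarrow> 'a set \<Rightarrow> (nat \<Rightarrow> nat \<Rightarrow> 'a) \<Rightarrow> nat \<Rightarrow> 'b set \<Rightarrow> (nat \<Rightarrow> nat \<Rightarrow> 'b) \<Rightarrow> bool" where
  "compatible k n X Y c S T \<longleftrightarrow>
     (\<exists>j0<n. \<exists>f g.
        bij_betw f (derived_columns k X Y j0) {..<c} \<and>
        bij_betw g (derived_symbols n j0) S \<and>
        (\<forall>i<k. \<forall>s\<in>derived_columns k X Y j0. g (derived_entry n Y i s) = T i (f s)))"

end

theory Submission
  imports Defs
begin

text \<open>
  Counting forces \<open>r = e + 1\<close>, \<open>c = e\<^sup>2\<close> and \<open>v = r e\<close>: the columns and symbols of \<open>T\<close> are the points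
  and lines of an affine plane of order \<open>e\<close>.  Every symbol is missing from exactly one row, and the
  symbols missing from a given row form a parallel class.  Exchanging the columns and symbols of
  \<open>T\<close> therefore leaves one empty cell in each column; add a further column listing \<open>r\<close> new symbols,
  and fill the empty cells of each row bijectively with the remaining \<open>r - 1 = e\<close> new symbols.  Two
  columns then share a point if the lines meet, plus a new symbol if they carry the same one.
\<close>

section \<open>Counting in triple arrays\<close>

locale triple_arr =
  fixes v e lrr lcc lrc r c :: nat and S :: "'a set" and T :: "nat \<Rightarrow> nat \<Rightarrow> 'a"
  assumes ta: "triple_array v e lrr lcc lrc r c S T"
begin

abbreviation "R \<equiv> row_symbols c T"
abbreviation "C \<equiv> column_symbols r T"

lemma r_ge_2: "r \<ge> 2" and c_ge_2: "c \<ge> 2" and finite_S: "finite S" and card_S: "card S = v"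
  using ta by (auto simp: triple_array_def)

lemma entry_in_S: "i < r \<Longrightarrow> j < c \<Longrightarrow> T i j \<in> S"
  using ta by (auto simp: triple_array_def is_array_def)

lemma row_inj: "i < r \<Longrightarrow> inj_on (\<lambda>j. T i j) {..<c}"
  and col_inj: "j < c \<Longrightarrow> inj_on (\<lambda>i. T i j) {..<r}"
  using ta by (auto simp: triple_array_def no_repetition_def)

lemma row_eqD: "T i j = T i j' \<Longrightarrow> i < r \<Longrightarrow> j < c \<Longrightarrow> j' < c \<Longrightarrow> j = j'"
  using row_inj by (auto dest: inj_onD)

lemma col_eqD: "T i j = T i' j \<Longrightarrow> i < r \<Longrightarrow> i' < r \<Longrightarrow> j < c \<Longrightarrow> i = i'"
  using col_inj by (auto dest: inj_onD)

lemma R_eq: "R i = (\<lambda>j. T i j) ` {..<c}"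
  by (auto simp: row_symbols_def)

lemma C_eq: "C j = (\<lambda>i. T i j) ` {..<r}"
  by (auto simp: column_symbols_def)

lemma R_subset: "i < r \<Longrightarrow> R i \<subseteq> S" and C_subset: "j < c \<Longrightarrow> C j \<subseteq> S"
  by (auto simp: R_eq C_eq entry_in_S)

lemma card_R: "i < r \<Longrightarrow> card (R i) = c" and card_C: "j < c \<Longrightarrow> card (C j) = r"
  by (simp_all add: R_eq C_eq card_image row_inj col_inj)

lemma finite_C: "finite (C j)"
  by (simp add: C_eq)

lemma card_occurrences: "x \<in> S \<Longrightarrow> card {(i, j). i < r \<and> j < c \<and> T i j = x} = e"
  using ta by (auto simp: triple_array_def)

lemma card_columns_containing:
  assumes "x \<in> S" shows "card {j. j < c \<and> x \<in> C j} = e"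
proof -
  have "bij_betw snd {(i, j). i < r \<and> j < c \<and> T i j = x} {j. j < c \<and> x \<in> C j}"
    by (auto simp: bij_betw_def inj_on_def C_eq image_iff dest: col_eqD)
  then show ?thesis using card_occurrences[OF assms] by (simp add: bij_betw_same_card)
qed

lemma card_rows_containing:
  assumes "x \<in> S" shows "card {i. i < r \<and> x \<in> R i} = e"
proof -
  have "bij_betw fst {(i, j). i < r \<and> j < c \<and> T i j = x} {i. i < r \<and> x \<in> R i}"
    by (force simp: bij_betw_def inj_on_def R_eq image_iff dest: row_eqD)
  then show ?thesis using card_occurrences[OF assms] by (simp add: bij_betw_same_card)
qed

text \<open>Double counting of the pairs of a symbol in \<open>A\<close> and a column containing it.
  The counts below take \<open>A\<close> to be \<open>S\<close>, a row, and a column.\<close>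

lemma sum_card_inter_C:
  assumes "A \<subseteq> S" shows "(\<Sum>j<c. card (A \<inter> C j)) = card A * e"
proof -
  have fin: "finite A" using assms finite_S finite_subset by blast
  have "(\<Sum>j<c. card {x\<in>A. x \<in> C j}) = e * card A"
    by (rule sum_multicount)
      (use assms fin card_columns_containing in \<open>auto simp: lessThan_def\<close>)
  then show ?thesis by (simp add: Int_def mult.commute)
qed

lemma card_cells: "c * r = v * e"
  using sum_card_inter_C[of S] by (simp add: Int_absorb1 C_subset card_C card_S)

lemma card_R_inter_C: "i < r \<Longrightarrow> j < c \<Longrightarrow> card (R i \<inter> C j) = lrc"
  and card_C_inter_C: "j < c \<Longrightarrow> j' < c \<Longrightarrow> j \<noteq> j' \<Longrightarrow> card (C j \<inter> C j') = lcc"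
  using ta by (simp_all add: triple_array_def)

text \<open>Taking \<open>A\<close> to be row 0 gives \<open>c * lrc = c * e\<close>.\<close>

lemma lrc_eq_e: "lrc = e"
  using sum_card_inter_C[OF R_subset, of 0] r_ge_2 c_ge_2
  by (simp add: card_R_inter_C card_R)

text \<open>Here \<open>A\<close> is column 0: it meets itself in \<open>r\<close> symbols and each
  of the other \<open>c - 1\<close> columns in \<open>lcc\<close>.\<close>

lemma column_degree: "r + (c - 1) * lcc = r * e"
proof -
  have "(\<Sum>j<c. card (C 0 \<inter> C j)) = card (C 0 \<inter> C 0) + (\<Sum>j\<in>{..<c} - {0}. card (C 0 \<inter> C j))"
    using c_ge_2 by (intro sum.remove) auto
  also have "(\<Sum>j\<in>{..<c} - {0}. card (C 0 \<inter> C j)) = (\<Sum>j\<in>{..<c} - {0}. lcc)"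
    by (rule sum.cong) (use c_ge_2 in \<open>auto intro: card_C_inter_C\<close>)
  finally show ?thesis
    using sum_card_inter_C[OF C_subset, of 0] c_ge_2 by (simp add: card_C)
qed

end

section \<open>The affine case\<close>

locale affine_triple_arr = triple_arr v e lrr 1 lrc r c S T
  for v e lrr lrc r c :: nat and S :: "'a set" and T :: "nat \<Rightarrow> nat \<Rightarrow> 'a" +
  assumes v_eq: "v = r + c - 1"
begin

text \<open>With column intersection 1, the left side of \<open>column_degree\<close> is
  \<open>r + c - 1\<close>, which is \<open>v\<close>.\<close>

lemma v_eq_re: "v = r * e"
  using column_degree v_eq c_ge_2 by simp

lemma c_eq: "c = e * e"
  using card_cells v_eq_re r_ge_2 by simp

lemma e_ge_2: "e \<ge> 2"
proof (rule ccontr)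
  assume "\<not> e \<ge> 2"
  then have "e = 0 \<or> e = 1" by auto
  then show False using c_eq c_ge_2 by auto
qed

lemma r_eq: "r = Suc e"
proof -
  \<comment> \<open>Over the integers, \<open>v = r * e\<close>, \<open>c = e * e\<close> and
    \<open>v = r + c - 1\<close> combine into a product with the factors \<open>e - 1\<close> and
    \<open>r - (e + 1)\<close>; the first is nonzero.\<close>
  have "int r * int e = int r + int e * int e - 1"
    using v_eq v_eq_re c_eq c_ge_2 by (simp flip: of_nat_mult)
  then have "(int e - 1) * (int r - (int e + 1)) = 0" by (simp add: algebra_simps)
  then show ?thesis using e_ge_2 by auto
qed

text \<open>No row repeats a symbol, so \<open>x\<close> occurs in exactly \<open>e\<close> of the
  \<open>e + 1\<close> rows.\<close>

lemma card_missing_rows: "x \<in> S \<Longrightarrow> card {i. i < r \<and> x \<notin> R i} = 1"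
proof -
  assume x: "x \<in> S"
  have "{i. i < r \<and> x \<notin> R i} = {..<r} - {i. i < r \<and> x \<in> R i}" by auto
  then show ?thesis using card_rows_containing[OF x]
      card_Diff_subset[of "{i. i < r \<and> x \<in> R i}" "{..<r}"] r_eq by auto
qed

lemma ex1_missing_row:
  assumes "x \<in> S" shows "\<exists>!i. i < r \<and> x \<notin> R i"
proof -
  obtain k where k: "{i. i < r \<and> x \<notin> R i} = {k}"
    by (rule card_1_singletonE[OF card_missing_rows[OF assms]])
  have "i < r \<and> x \<notin> R i \<longleftrightarrow> i = k" for i
    using arg_cong[OF k, of "\<lambda>A. i \<in> A"] by simp
  then show ?thesis by simp
qed

lemma card_parallel_class:
  assumes "i < r" shows "card (S - R i) = e"
proof -
  have "card (S - R i) = v - c"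
    using card_Diff_subset[OF finite_subset[OF R_subset[OF assms] finite_S] R_subset[OF assms]]
    by (simp add: card_S card_R assms)
  then show ?thesis using v_eq r_eq by simp
qed

text \<open>Playfair's axiom: the point \<open>j\<close> lies on \<open>r = e + 1\<close> lines, and
  exactly \<open>lrc = e\<close> of them occur in row \<open>i\<close>.\<close>

lemma ex1_parallel:
  assumes "i < r" "j < c" shows "\<exists>!x. x \<in> C j - R i"
proof -
  have "card (C j - R i) = 1"
    using card_Diff_subset_Int[OF finite_Int[OF disjI1[OF finite_C]], of j "R i"]
      card_R_inter_C[OF assms] card_C[OF assms(2)] r_eq
    by (simp add: lrc_eq_e Int_commute)
  then show ?thesis by (metis card_1_singletonE singleton_iff)
qed

lemma points_unique:
  assumes "x \<noteq> y" "j < c" "j' < c" "x \<in> C j" "y \<in> C j" "x \<in> C j'" "y \<in> C j'"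
  shows "j = j'"
proof (rule ccontr)
  assume "j \<noteq> j'"
  then have "card (C j \<inter> C j') = 1" using card_C_inter_C assms by simp
  then obtain z where "C j \<inter> C j' = {z}" by (auto simp: card_1_singleton_iff)
  then show False using assms by (metis IntI singletonD)
qed

lemma common_points_le_1: "x \<noteq> y \<Longrightarrow> card {j. j < c \<and> x \<in> C j \<and> y \<in> C j} \<le> 1"
  using points_unique by (auto simp: card_le_Suc0_iff_eq)

text \<open>
  The \<open>e\<close> points of \<open>x\<close> lie on distinct lines of the parallel class of \<open>y\<close>, which has only \<open>e\<close> lines.
\<close>

lemma nonparallel_meet:
  assumes "x \<in> S" "x \<in> R i" "i < r" "y \<in> S" "y \<notin> R i"
  shows "\<exists>j<c. x \<in> C j \<and> y \<in> C j"
proof -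
  let ?P = "{j. j < c \<and> x \<in> C j}"
  define L where "L j = (THE z. z \<in> C j - R i)" for j
  have L: "L j \<in> C j - R i" if "j < c" for j
    unfolding L_def by (rule theI') (rule ex1_parallel[OF \<open>i < r\<close> that])
  have inj: "inj_on L ?P"
  proof (rule inj_onI)
    fix j j' assume j: "j \<in> ?P" "j' \<in> ?P" "L j = L j'"
    then have "x \<noteq> L j" using L assms by auto
    then show "j = j'" using L j points_unique[of x "L j" j j'] by force
  qed
  have "L ` ?P = S - R i"
  proof (rule card_subset_eq)
    show "L ` ?P \<subseteq> S - R i" using L C_subset by blast
    show "card (L ` ?P) = card (S - R i)"
      using inj card_columns_containing assms card_parallel_class by (simp add: card_image)
  qed (simp add: finite_S)
  then have "y \<in> L ` ?P" using assms by simp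
  then show ?thesis using L by auto
qed

section \<open>Labelling the lines of each parallel class\<close>

definition missing_row :: "'a \<Rightarrow> nat" where
  "missing_row x = (THE i. i < r \<and> x \<notin> R i)"

lemma missing_row: "x \<in> S \<Longrightarrow> missing_row x < r \<and> x \<notin> R (missing_row x)"
  unfolding missing_row_def by (rule theI') (rule ex1_missing_row)

lemma missing_row_eqI: "x \<in> S \<Longrightarrow> i < r \<Longrightarrow> x \<notin> R i \<Longrightarrow> missing_row x = i"
  using ex1_missing_row missing_row by blast

text \<open>Each class has \<open>e = r - 1\<close> lines, as many as there are labels other than
  \<open>i\<close>. The classes are disjoint, so the bijections chosen class by class glue to a
  single \<open>N\<close>.\<close>

lemma ex_filling: "\<exists>N. \<forall>i<r. bij_betw N (S - R i) ({..<r} - {i})"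
proof -
  have "\<exists>h. bij_betw h (S - R i) ({..<r} - {i})" if "i < r" for i
    using that card_parallel_class[OF that] r_eq finite_S by (intro finite_same_card_bij) auto
  then obtain h where h: "\<And>i. i < r \<Longrightarrow> bij_betw (h i) (S - R i) ({..<r} - {i})" by metis
  have "bij_betw (\<lambda>x. h (missing_row x) x) (S - R i) ({..<r} - {i})" if "i < r" for i
    by (rule bij_betw_cong[THEN iffD2, OF _ h[OF that]]) (use missing_row_eqI that in auto)
  then show ?thesis by blast
qed

end

section \<open>The Latin rectangle\<close>

text \<open>
  Column \<open>v\<close> of the rectangle is the removed column; column \<open>j < v\<close> belongs to the symbol \<open>g j\<close> of
  the triple array.  The symbols of the rectangle are the columns \<open>s < c\<close> of the triple array
  and the new symbols \<open>c + a\<close> for \<open>a < r\<close>.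
\<close>

locale affine_extension = affine_triple_arr v e lrr lrc r c S T
  for v e lrr lrc r c :: nat and S :: "'a set" and T :: "nat \<Rightarrow> nat \<Rightarrow> 'a" +
  fixes g :: "nat \<Rightarrow> 'a" and N :: "'a \<Rightarrow> nat"
  assumes g: "bij_betw g {..<v} S"
    and N: "i < r \<Longrightarrow> bij_betw N (S - R i) ({..<r} - {i})"
begin

definition Y :: "nat \<Rightarrow> nat \<Rightarrow> nat" where
  "Y i j = (if j = v then c + i
            else if g j \<in> R i then (THE s. s < c \<and> T i s = g j)
            else c + N (g j))"

lemma v_Suc: "Suc v = c + r"
  using v_eq r_ge_2 by simp

lemma g_in_S: "j < v \<Longrightarrow> g j \<in> S"
  using g bij_betwE by blast

lemma g_eqD: "g j = g j' \<Longrightarrow> j < v \<Longrightarrow> j' < v \<Longrightarrow> j = j'"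
  using g by (auto simp: bij_betw_def dest: inj_onD)

lemma g_surj: "x \<in> S \<Longrightarrow> \<exists>j<v. g j = x"
  using g by (auto simp: bij_betw_def)

lemma N_in: "i < r \<Longrightarrow> x \<in> S \<Longrightarrow> x \<notin> R i \<Longrightarrow> N x < r \<and> N x \<noteq> i"
  using bij_betwE[OF N] by blast

lemma N_lt: "x \<in> S \<Longrightarrow> N x < r"
  using N_in missing_row by blast

lemma N_eqD: "N x = N y \<Longrightarrow> i < r \<Longrightarrow> x \<in> S - R i \<Longrightarrow> y \<in> S - R i \<Longrightarrow> x = y"
  using bij_betw_imp_inj_on[OF N] by (blast dest: inj_onD)

lemma N_surj: "i < r \<Longrightarrow> a < r \<Longrightarrow> a \<noteq> i \<Longrightarrow> \<exists>x\<in>S - R i. N x = a"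
  using bij_betw_imp_surj_on[OF N[of i]] imageE[of a N "S - R i"] by auto

lemma Y_last: "Y i v = c + i"
  by (simp add: Y_def)

lemma Y_old:
  assumes "i < r" "s < c" "g j = T i s" "j < v" shows "Y i j = s"
proof -
  have "(THE s. s < c \<and> T i s = g j) = s"
    using assms by (auto intro!: the_equality dest: row_eqD)
  then show ?thesis using assms by (auto simp: Y_def R_eq)
qed

lemma Y_new: "j < v \<Longrightarrow> g j \<notin> R i \<Longrightarrow> Y i j = c + N (g j)"
  by (simp add: Y_def)

lemma Y_cases [consumes 2]:
  assumes "i < r" "j < Suc v"
  obtains (last) "j = v" "Y i j = c + i"
  | (old) s where "j < v" "s < c" "g j = T i s" "Y i j = s"
  | (new) "j < v" "g j \<in> S - R i" "Y i j = c + N (g j)" "N (g j) < r" "N (g j) \<noteq> i"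
proof (cases "j = v")
  case True
  then show thesis using last Y_last by simp
next
  case False
  then have j: "j < v" using assms by simp
  show thesis
  proof (cases "g j \<in> R i")
    case True
    then obtain s where "s < c" "g j = T i s" by (auto simp: R_eq)
    then show thesis using j assms old Y_old by blast
  next
    case False
    then show thesis using j assms new Y_new N_in g_in_S by auto
  qed
qed

text \<open>Values below \<open>c\<close> and values from \<open>c\<close> on cannot clash. Among
  the latter, \<open>N\<close> is injective on the class of row \<open>i\<close> and avoids
  \<open>i\<close>, the label used in the last column.\<close>

lemma Y_row_inj:
  assumes "i < r" shows "inj_on (\<lambda>j. Y i j) {..<Suc v}"
proof (rule inj_onI)
  fix j j' assume j: "j \<in> {..<Suc v}" "j' \<in> {..<Suc v}" and eq: "Y i j = Y i j'"
  from j have "j < Suc v" "j' < Suc v" by auto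
  from \<open>i < r\<close> this(1) show "j = j'"
  proof (cases rule: Y_cases)
    case last
    from \<open>i < r\<close> \<open>j' < Suc v\<close> show ?thesis by (cases rule: Y_cases) (use last eq in auto)
  next
    case (old s)
    from \<open>i < r\<close> \<open>j' < Suc v\<close> show ?thesis
      by (cases rule: Y_cases) (use old eq in \<open>auto intro: g_eqD\<close>)
  next
    case new
    note j_new = new
    from \<open>i < r\<close> \<open>j' < Suc v\<close> show ?thesis
    proof (cases rule: Y_cases)
      case last
      then show ?thesis using j_new eq by simp
    next
      case (old s)
      then show ?thesis using j_new eq by simp
    next
      case new
      then have "N (g j) = N (g j')" using j_new eq by simp
      from N_eqD[OF this \<open>i < r\<close> j_new(2) new(2)] show ?thesis
        using g_eqD j_new new by simp
    qed
  qed
qed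

text \<open>Apart from the last column, a column holds only one new symbol, because its line is
  missing from only one row. Two equal old entries would repeat a symbol in a column of
  \<open>T\<close>.\<close>

lemma Y_col_inj:
  assumes "j < Suc v" shows "inj_on (\<lambda>i. Y i j) {..<r}"
proof (rule inj_onI)
  fix i i' assume "i \<in> {..<r}" "i' \<in> {..<r}" and eq: "Y i j = Y i' j"
  then have i: "i < r" "i' < r" by auto
  from i(1) assms show "i = i'"
  proof (cases rule: Y_cases)
    case last
    then show ?thesis using eq Y_last by simp
  next
    case (old s)
    from i(2) assms show ?thesis
      by (cases rule: Y_cases) (use old eq i in \<open>auto dest: col_eqD\<close>)
  next
    case new
    from i(2) assms show ?thesis
      by (cases rule: Y_cases) (use new eq i ex1_missing_row[of "g j"] in auto)
  qed
qed

lemma latin_rectangle_Y: "latin_rectangle r (Suc v) {..<Suc v} Y"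
proof -
  have "Y i j < Suc v" if "i < r" "j < Suc v" for i j
    using that by (cases rule: Y_cases) (use that v_Suc in auto)
  then show ?thesis
    by (auto simp: latin_rectangle_def is_array_def no_repetition_def Y_row_inj Y_col_inj)
qed

section \<open>Intersections of columns of the rectangle\<close>

lemma column_symbols_last: "column_symbols r Y v = {c..<c + r}"
  by (auto simp: column_symbols_def Y_last le_iff_add)

lemma column_symbols_Y:
  assumes "j < v"
  shows "column_symbols r Y j = insert (c + N (g j)) {s. s < c \<and> g j \<in> C s}"
proof (intro equalityI subsetI)
  fix s assume "s \<in> column_symbols r Y j"
  then obtain i where i: "i < r" "s = Y i j" by (auto simp: column_symbols_def)
  from i(1) less_SucI[OF assms] show "s \<in> insert (c + N (g j)) {s. s < c \<and> g j \<in> C s}"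
    by (cases rule: Y_cases) (use i assms in \<open>auto simp: C_eq\<close>)
next
  fix s assume "s \<in> insert (c + N (g j)) {s. s < c \<and> g j \<in> C s}"
  then consider "s = c + N (g j)" | "s < c" "g j \<in> C s" by auto
  then show "s \<in> column_symbols r Y j"
  proof cases
    case 1
    then have "s = Y (missing_row (g j)) j" "missing_row (g j) < r"
      using missing_row[OF g_in_S[OF assms]] Y_new[OF assms] by simp_all
    then show ?thesis by (auto simp: column_symbols_def)
  next
    case 2
    then obtain i where "i < r" "g j = T i s" by (auto simp: C_eq)
    then have "s = Y i j" using 2 assms Y_old by simp
    then show ?thesis using \<open>i < r\<close> by (auto simp: column_symbols_def)
  qed
qed

lemma card_inter_last:
  assumes "j < v" shows "card (column_symbols r Y j \<inter> column_symbols r Y v) = 1"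
proof -
  have "column_symbols r Y j \<inter> column_symbols r Y v = {c + N (g j)}"
    using assms N_lt g_in_S by (auto simp: column_symbols_last column_symbols_Y)
  then show ?thesis by simp
qed

text \<open>Points lie below \<open>c\<close> and new symbols do not, so common points and a common
  new symbol are counted separately.\<close>

lemma card_inter_Y:
  assumes "j < v" "j' < v"
  shows "card (column_symbols r Y j \<inter> column_symbols r Y j') =
    card {s. s < c \<and> g j \<in> C s \<and> g j' \<in> C s} + (if N (g j) = N (g j') then 1 else 0)"
proof -
  let ?M = "{s. s < c \<and> g j \<in> C s \<and> g j' \<in> C s}"
  have "column_symbols r Y j \<inter> column_symbols r Y j' =
      (if N (g j) = N (g j') then insert (c + N (g j)) ?M else ?M)"
    using assms by (auto simp: column_symbols_Y)
  then show ?thesis by simp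
qed

lemma column_intersection_sizes_Y:
  "column_intersection_sizes r (Suc v) Y = {0, 1, 2}"
proof (intro equalityI subsetI)
  fix k assume "k \<in> column_intersection_sizes r (Suc v) Y"
  then obtain j j' where k: "k = int (card (column_symbols r Y j \<inter> column_symbols r Y j'))"
    and j: "j < Suc v" "j' < Suc v" "j \<noteq> j'"
    by (auto simp: column_intersection_sizes_def)
  consider "j = v" "j' < v" | "j' = v" "j < v" | "j < v" "j' < v" using j by linarith
  then show "k \<in> {0, 1, 2}"
  proof cases
    case 3
    then have "g j \<noteq> g j'" using j g_eqD by blast
    from common_points_le_1[OF this] have "k \<le> 2" by (simp add: k card_inter_Y 3)
    then show ?thesis using k by auto
  qed (simp_all add: k card_inter_last Int_commute)
next
  have sizeI: "int (card (column_symbols r Y j \<inter> column_symbols r Y j'))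
      \<in> column_intersection_sizes r (Suc v) Y" if "j < v" "j' < Suc v" "j \<noteq> j'" for j j'
    using that less_SucI by (fastforce simp: column_intersection_sizes_def)
  have r3: "r \<ge> 3" using r_eq e_ge_2 by simp
  have v0: "v > 0" using v_eq c_ge_2 r_ge_2 by simp
  fix k :: int assume "k \<in> {0, 1, 2}"
  then consider "k = 0" | "k = 1" | "k = 2" by auto
  then show "k \<in> column_intersection_sizes r (Suc v) Y"
  proof cases
    case 1
    \<comment> \<open>Size 0: two lines of one parallel class with different labels. Labels 1 and 2
      both occur in the class of row 0 since \<open>r \<ge> 3\<close>.\<close>
    obtain x where x: "x \<in> S - R 0" "N x = 1" using N_surj[of 0 1] r3 by auto
    obtain y where y: "y \<in> S - R 0" "N y = 2" using N_surj[of 0 2] r3 by auto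
    obtain j j' where j: "j < v" "j' < v" "g j = x" "g j' = y" using g_surj x y by blast
    \<comment> \<open>A common point would lie on two lines of the same class.\<close>
    have none: "{s. s < c \<and> x \<in> C s \<and> y \<in> C s} = {}"
      using ex1_parallel[of 0] r3 x y by fastforce
    then have "card (column_symbols r Y j \<inter> column_symbols r Y j') = 0"
      using card_inter_Y[OF j(1,2)] none j(3,4) x(2) y(2) by simp
    moreover have "j \<noteq> j'" using j x y by auto
    ultimately show ?thesis using sizeI[of j j'] j 1 by simp
  next
    case 2
    \<comment> \<open>Size 1: any other column against the removed one.\<close>
    then show ?thesis using sizeI[of 0 v] card_inter_last v0 by simp
  next
    case 3
    \<comment> \<open>Size 2: lines of different classes meet in a point, and equal labels add a new
      symbol. The classes of rows 0 and 1 omit the labels 0 and 1 respectively, so 2 is the first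
      label available in both.\<close>
    obtain x where x: "x \<in> S - R 0" "N x = 2" using N_surj[of 0 2] r3 by auto
    obtain y where y: "y \<in> S - R 1" "N y = 2" using N_surj[of 1 2] r3 by auto
    obtain j j' where j: "j < v" "j' < v" "g j = x" "g j' = y" using g_surj x y by blast
    have xR: "x \<in> R 1" using missing_row_eqI[of x 0] missing_row_eqI[of x 1] x r3 by force
    then have "x \<noteq> y" using y by auto
    obtain s where s: "s < c" "x \<in> C s" "y \<in> C s"
      using nonparallel_meet[of x 1 y] x y xR r3 by auto
    have "card {s. s < c \<and> x \<in> C s \<and> y \<in> C s} \<noteq> 0" using s by auto
    then have "card {s. s < c \<and> x \<in> C s \<and> y \<in> C s} = 1"
      using common_points_le_1[OF \<open>x \<noteq> y\<close>] by linarith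
    then have "card (column_symbols r Y j \<inter> column_symbols r Y j') = 2"
      using card_inter_Y[OF j(1,2)] j(3,4) x(2) y(2) by simp
    moreover have "j \<noteq> j'" using j \<open>x \<noteq> y\<close> by auto
    ultimately show ?thesis using sizeI[of j j'] j 3 by simp
  qed
qed

lemma triple_intersection_Y:
  "triple_intersection_latin_rectangle r (Suc v) {..<Suc v} Y"
proof -
  \<comment> \<open>As \<open>n - 1 = v\<close>, this gives \<lambda> = 1, which matches the sizes
    0, 1 and 2.\<close>
  have "r * (r - 1) = v" "v > 0" using v_eq_re r_eq e_ge_2 by auto
  then show ?thesis
    by (simp add: triple_intersection_latin_rectangle_def latin_rectangle_Y
        column_intersection_sizes_Y Let_def)
qed

section \<open>Recovering the triple array\<close>

lemma compatible_Y: "compatible r (Suc v) {..<Suc v} Y c S T"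
proof -
  have cols: "derived_columns r {..<Suc v} Y v = {..<c}"
    using v_Suc by (auto simp: derived_columns_def column_symbols_last)
  have syms: "derived_symbols (Suc v) v = {..<v}"
    by (auto simp: derived_symbols_def)
  have "g (derived_entry (Suc v) Y i s) = T i s" if i: "i < r" and s: "s < c" for i s
  proof -
    obtain j where j: "j < v" "g j = T i s" using g_surj entry_in_S i s by blast
    have "derived_entry (Suc v) Y i s = j"
      unfolding derived_entry_def
    proof (rule the_equality)
      show "j < Suc v \<and> Y i j = s" using j i s Y_old by simp
      fix j' assume "j' < Suc v \<and> Y i j' = s"
      then show "j' = j" using inj_onD[OF Y_row_inj[OF i], of j' j] j Y_old[OF i s] by simp
    qed
    then show ?thesis using j by simp
  qed
  moreover have "bij_betw id {..<c} {..<c}" by simp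
  ultimately show ?thesis
    unfolding compatible_def using g cols syms
    \<comment> \<open>The surviving symbols of \<open>Y\<close> are the column indices of
      \<open>T\<close> themselves, so columns are matched by \<open>id\<close>.\<close>
    by (intro exI[of _ v] conjI exI[of _ id] exI[of _ g]) auto
qed

end

theorem theorem5p6:
  fixes T :: "nat \<Rightarrow> nat \<Rightarrow> 'a" and S :: "'a set"
    and v e lrr lrc r c :: nat
  assumes "triple_array v e lrr 1 lrc r c S T"
    and "v = r + c - 1"
  shows "\<exists>Y :: nat \<Rightarrow> nat \<Rightarrow> nat.
           triple_intersection_latin_rectangle r (v + 1) {..<v + 1} Y \<and>
           column_intersection_sizes r (v + 1) Y = {0, 1, 2} \<and>
           compatible r (v + 1) {..<v + 1} Y c S T"
proof -
  interpret affine_triple_arr v e lrr lrc r c S T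
    using assms by unfold_locales
  obtain g where g: "bij_betw g {..<v} S"
    using ex_bij_betw_nat_finite[OF finite_S] card_S by (auto simp: atLeast0LessThan)
  obtain N where N: "\<And>i. i < r \<Longrightarrow> bij_betw N (S - R i) ({..<r} - {i})"
    using ex_filling by blast
  interpret affine_extension v e lrr lrc r c S T g N
    using g N by unfold_locales
  show ?thesis
    using triple_intersection_Y column_intersection_sizes_Y compatible_Y by auto
qed

end
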